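(* There exist absolute constants $C_1,C_2>0$ such that for every real $v\in(0,1)$ and every sufficiently large real $Q$ (that is, for all $Q\ge Q_0$ with some $Q_0=Q_0(v)$) one has $$C_1\,Q^{3-2v}\ \le\ \#\mathcal{D}_2(Q,v)\ \le\ C_2\,Q^{3-2v}.$$
   Context: For $Q>1$ and real $v$, $$\mathcal{D}_2(Q,v)=\{P\in\mathbb{Z}[x]:\deg P=2,\ H(P)\le Q,\ 1\le|D(P)|\le Q^{2-2v}\},$$ where, for $P=ax^2+bx+c$ with $a\ne0$, $H(P)=\max\{|a|,|b|,|c|\}$ is the height and $D(P)=b^2-4ac$ is the discriminant. The paper states the result as $\#\mathcal{D}_2(Q,v)\asymp Q^{3-2v}$, with the convention that $X\asymp Y$ means $X\le CY$ and $Y\le C'X$ for constants $C,C'$ depending only on the degree $n$ (here $n=2$). *)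

theory Defs
  imports Complex_Main "HOL-Computational_Algebra.Polynomial"
begin

text \<open>The two functions below are meant for polynomials of degree two,
  \<open>P = a x\<^sup>2 + b x + c\<close> with \<open>a = coeff P 2\<close>, \<open>b = coeff P 1\<close>, \<open>c = coeff P 0\<close>.\<close>

definition quad_height :: "int poly \<Rightarrow> int" where
  "quad_height P = Max {\<bar>coeff P 2\<bar>, \<bar>coeff P 1\<bar>, \<bar>coeff P 0\<bar>}"

definition quad_discr :: "int poly \<Rightarrow> int" where
  "quad_discr P = (coeff P 1)\<^sup>2 - 4 * coeff P 2 * coeff P 0"

definition D2 :: "real \<Rightarrow> real \<Rightarrow> int poly set" where
  "D2 Q v = {P. degree P = 2 \<and> real_of_int (quad_height P) \<le> Q \<and>
                1 \<le> \<bar>quad_discr P\<bar> \<and> real_of_int \<bar>quad_discr P\<bar> \<le> Q powr (2 - 2 * v)}"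

text \<open>Finiteness, so that \<^term>\<open>card (D2 Q v)\<close> is the genuine number of elements.\<close>

lemma finite_D2: "finite (D2 Q v)"
proof -
  let ?I = "{- \<lfloor>Q\<rfloor>..\<lfloor>Q\<rfloor>}"
  have "D2 Q v \<subseteq> (\<lambda>(a, b, c). [:c, b, a:]) ` (?I \<times> ?I \<times> ?I)"
  proof
    fix P assume P: "P \<in> D2 Q v"
    have "quad_height P \<le> \<lfloor>Q\<rfloor>"
      using P by (simp add: D2_def le_floor_iff)
    then have bounds: "coeff P 2 \<in> ?I" "coeff P 1 \<in> ?I" "coeff P 0 \<in> ?I"
      by (auto simp: quad_height_def)
    have "P = [:coeff P 0, coeff P 1, coeff P 2:]"
    proof (rule poly_eqI)
      fix n
      have "degree P = 2" using P by (simp add: D2_def)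
      then show "coeff P n = coeff [:coeff P 0, coeff P 1, coeff P 2:] n"
        by (cases "n \<le> 2")
           (auto simp: coeff_pCons coeff_eq_0 numeral_2_eq_2 le_Suc_eq split: nat.split)
    qed
    with bounds show "P \<in> (\<lambda>(a, b, c). [:c, b, a:]) ` (?I \<times> ?I \<times> ?I)"
      by (intro image_eqI[of _ _ "(coeff P 2, coeff P 1, coeff P 0)"]) auto
  qed
  then show ?thesis
    by (rule finite_subset) simp
qed

end

theory Submission
  imports Defs "HOL-Analysis.Kronecker_Approximation_Theorem"
begin

text \<open>Write \<open>S = Q\<^sup>1\<^sup>-\<^sup>v\<close>, so that the discriminants in question are bounded by \<open>S\<^sup>2\<close> and the
  claim is that the number of forms \<open>f(X, Z) = a X\<^sup>2 + b X Z + c Z\<^sup>2\<close> with coefficients bounded by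
  \<open>Q\<close> and nonzero discriminant \<open>D\<close>, \<open>\<bar>D\<bar> \<le> S\<^sup>2\<close>, has order \<open>Q S\<^sup>2\<close>. Because of
  \<open>0 < v < 1\<close>, for large \<open>Q\<close> the number \<open>S\<close> exceeds \<open>ln (2 Q + 1)\<close> and is small compared with \<open>Q\<close>.

  Upper bound. By symmetry let \<open>\<bar>c\<bar> \<le> \<bar>a\<bar>\<close>; the forms with \<open>\<bar>a\<bar> < S\<close> number only
  \<open>O(S\<^sup>3)\<close>. Otherwise \<open>f\<close> is, up to the factor \<open>a\<close>, nearly the square of \<open>X + b/(2a) Z\<close>.
  Approximating \<open>- b/(2a)\<close> by a fraction \<open>x/y\<close> by Dirichlet's theorem yields a primitive vector
  \<open>(x, y)\<close> with \<open>y \<le> 2 \<surd>(Q/S)\<close> at which the value \<open>m = f(x, y)\<close> is at most \<open>2 S\<close> in size and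
  the derivative \<open>L = 2 a x + b y\<close> at most \<open>2 \<surd>(Q S)\<close> (\<open>exists_small_value\<close>). Conversely, for
  given \<open>(x, y, m)\<close> the number \<open>L\<close> is fixed modulo \<open>y\<close>; for given \<open>L\<close> the coefficient \<open>a\<close> is
  fixed modulo \<open>y\<^sup>2\<close>, and \<open>a\<close> lies in an interval of length \<open>2 Q\<close> because of the height
  and, if \<open>m \<noteq> 0\<close>, in one of length \<open>S\<^sup>2 y\<^sup>2/(2 \<bar>m\<bar>)\<close> because of the identity
  \<open>L\<^sup>2 - 4 a m = D y\<^sup>2\<close>. This leaves \<open>O(\<surd>(Q S)/y \<cdot> min (S\<^sup>2/\<bar>m\<bar>) (Q/y\<^sup>2))\<close> forms.
  Keeping the minimum is what matters: summed over \<open>y\<close>, \<open>O(y)\<close> values of \<open>x\<close>, and \<open>m\<close>, it gives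
  \<open>O(Q S\<^sup>2)\<close>, whereas \<open>S\<^sup>2/\<bar>m\<bar>\<close> alone would cost a factor \<open>ln S\<close> and \<open>Q/y\<^sup>2\<close> alone a factor
  \<open>\<surd>(Q/S)\<close>. The forms with \<open>m = 0\<close>, which have a square discriminant, contribute \<open>O(Q S ln Q)\<close>,
  which is absorbed since \<open>ln Q\<close> is smaller than \<open>S\<close>.

  Lower bound. There are of order \<open>S\<^sup>3\<close> positive definite forms \<open>m X\<^sup>2 + n X Z + k Z\<^sup>2\<close> with
  \<open>0 < n < m < k\<close> and \<open>k \<le> 3 S/5\<close>, whose shortest vector is \<open>(1, 0)\<close>. Such a form can be moved
  by a unimodular matrix so that its shortest vector becomes any given primitive \<open>(x, y)\<close> with
  \<open>0 < x, y \<le> \<surd>(Q/(3 S))\<close>, and the height stays below \<open>Q\<close>. Since the shortest vector is unique up to sign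
  (\<open>reduced_form_min\<close>), the resulting forms are distinct, and there are of order
  \<open>Q/S \<cdot> S\<^sup>3\<close> of them because a positive proportion of all vectors is primitive
  (\<open>card_coprime_pairs_ge\<close>).\<close>

section \<open>Elementary sums and integers in arithmetic progressions\<close>

lemma sum_le_telescope:
  fixes f G :: "int \<Rightarrow> real"
  assumes "0 \<le> n" and "\<And>y. 1 \<le> y \<Longrightarrow> y \<le> n \<Longrightarrow> f y \<le> G y - G (y - 1)"
  shows "sum f {1..n} \<le> G n - G 0"
  using assms
proof (induction n rule: int_ge_induct)
  case base
  then show ?case by simp
next
  case (step i)
  have "{1..i + 1} = insert (i + 1) {1..i}"
    using step by auto
  moreover have "f (i + 1) \<le> G (i + 1) - G i"
    using step.prems[of "i + 1"] step.hyps by simp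
  moreover have "sum f {1..i} \<le> G i - G 0"
    using step by simp
  ultimately show ?case by simp
qed

text \<open>The two functions cross at \<open>y = z\<close> with \<open>z = \<surd>(\<beta>/\<alpha>)\<close>. Both are bounded on the
  relevant side of \<open>z\<close> by \<open>4 \<alpha> z\<^sup>2/(y + z)\<^sup>2\<close>, which is dominated by a telescoping difference of
  \<open>4 \<alpha> z \<cdot> y/(y + z)\<close>.\<close>
lemma sum_min_inverse_square_le:
  fixes \<alpha> \<beta> :: real
  assumes "0 \<le> n" "0 < \<alpha>" "0 < \<beta>"
  shows "(\<Sum>y\<in>{1..n::int}. min \<alpha> (\<beta> / (of_int y)^2)) \<le> 4 * sqrt (\<alpha> * \<beta>)"
proof -
  define z where "z = sqrt (\<beta> / \<alpha>)"
  have z: "z > 0" "\<beta> = \<alpha> * z^2"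
    using assms by (auto simp: z_def)
  then have sq: "sqrt (\<alpha> * \<beta>) = \<alpha> * z"
    using assms by (simp add: real_sqrt_mult)
  define G where "G = (\<lambda>y::int. 4 * \<alpha> * z * (y / (y + z)))"
  have "(\<Sum>y\<in>{1..n::int}. min \<alpha> (\<beta> / (of_int y)^2)) \<le> G n - G 0"
  proof (rule sum_le_telescope[OF assms(1)])
    fix y :: int assume "1 \<le> y"
    then have y: "1 \<le> real_of_int y" by simp
    have m: "min \<alpha> (\<beta> / (of_int y)^2) \<le> 4 * \<alpha> * z^2 / (y + z)^2"
    proof (cases "real_of_int y \<le> z")
      case True
      have "(y + z)^2 \<le> (2 * z)^2"
        using True y by (intro power_mono) auto
      then have "\<alpha> * (y + z)^2 \<le> \<alpha> * (4 * z^2)"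
        using assms(2) by (intro mult_left_mono) (auto simp: power_mult_distrib)
      then have "\<alpha> \<le> 4 * \<alpha> * z^2 / (y + z)^2"
        using y z by (simp add: field_simps)
      then show ?thesis by linarith
    next
      case False
      have "(y + z)^2 \<le> (2 * real_of_int y)^2"
        using False y z by (intro power_mono) auto
      then have "\<beta> * (y + z)^2 \<le> \<beta> * (4 * (of_int y)^2)"
        using assms(3) by (intro mult_left_mono) (auto simp: power_mult_distrib)
      then have "\<beta> / (of_int y)^2 \<le> 4 * \<beta> / (y + z)^2"
        using y z by (simp add: field_simps)
      then show ?thesis using z(2) by (simp add: mult.assoc)
    qed
    have p: "0 < y - 1 + z" "0 < y + z" using y z by auto
    have "(y + z) * (y - 1 + z) \<le> (y + z)^2"
      using p by (simp add: power2_eq_square)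
    then have "4 * \<alpha> * z^2 / (y + z)^2 \<le> 4 * \<alpha> * z^2 / ((y + z) * (y - 1 + z))"
      using p assms by (intro divide_left_mono mult_pos_pos) auto
    also have "\<dots> = G y - G (y - 1)"
      using p by (simp add: G_def field_simps power2_eq_square)
    finally show "min \<alpha> (\<beta> / (of_int y)^2) \<le> G y - G (y - 1)"
      using m by linarith
  qed
  also have "\<dots> \<le> 4 * \<alpha> * z * 1"
  proof -
    have "real_of_int n / (n + z) \<le> 1" using assms z by simp
    then have "4 * \<alpha> * z * (real_of_int n / (n + z)) \<le> 4 * \<alpha> * z * 1"
      using assms z by (intro mult_left_mono) auto
    then show ?thesis by (simp add: G_def)
  qed
  finally show ?thesis using sq by simp
qed

lemma sum_inverse_sqrt_le:
  assumes "0 \<le> n"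
  shows "(\<Sum>m\<in>{1..n::int}. 1 / sqrt m) \<le> 2 * sqrt n"
proof -
  have "(\<Sum>m\<in>{1..n::int}. 1 / sqrt m) \<le> 2 * sqrt n - 2 * sqrt (0::int)"
  proof (rule sum_le_telescope[OF assms])
    fix m :: int assume "1 \<le> m"
    then have m: "1 \<le> real_of_int m" by simp
    have "(sqrt m - sqrt (m - 1))^2 \<ge> 0" by simp
    then have "2 * (sqrt m * sqrt (m - 1)) \<le> 2 * m - 1"
      using m by (simp add: power2_diff)
    then have "1 \<le> (2 * sqrt m - 2 * sqrt (m - 1)) * sqrt m"
      using m real_sqrt_mult_self[of m] by (simp add: algebra_simps del: real_sqrt_mult_self)
    then show "1 / sqrt m \<le> 2 * sqrt m - 2 * sqrt (m - 1 :: int)"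
      using m by (simp add: divide_le_eq)
  qed
  then show ?thesis by simp
qed

lemma sum_inverse_le_ln:
  assumes "0 \<le> n"
  shows "(\<Sum>y\<in>{1..n::int}. 1 / y) \<le> 2 * ln (n + 1)"
proof -
  have "(\<Sum>y\<in>{1..n::int}. 1 / real_of_int y) \<le> 2 * ln (n + 1) - 2 * ln (0 + 1::int)"
  proof (rule sum_le_telescope[OF assms])
    fix y :: int assume "1 \<le> y"
    then have y: "1 \<le> real_of_int y" by simp
    have "ln (y / (y + 1)) \<le> y / (y + 1) - 1"
      using y by (intro ln_le_minus_one) auto
    then have "1 / (y + 1) \<le> ln (y + 1) - ln y"
      using y by (simp add: ln_div field_simps)
    moreover have "1 / y \<le> 2 * (1 / (y + 1))"
      using y by (simp add: field_simps)
    ultimately show "1 / y \<le> 2 * ln (y + 1) - 2 * ln (y - 1 + 1 :: int)"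
      by simp
  qed
  then show ?thesis by simp
qed

lemma card_spaced_le:
  fixes X :: "int set" and lo hi :: real and q :: int
  assumes "\<And>i. i \<in> X \<Longrightarrow> lo \<le> i \<and> i \<le> hi"
    and "\<And>i j. i \<in> X \<Longrightarrow> j \<in> X \<Longrightarrow> q dvd i - j"
    and "q > 0" "lo \<le> hi"
  shows "finite X \<and> card X \<le> 1 + (hi - lo) / q"
proof (cases "X = {}")
  case True
  then show ?thesis using assms by simp
next
  case False
  have "X \<subseteq> {\<lceil>lo\<rceil>..\<lfloor>hi\<rfloor>}"
    using assms(1) by (auto simp: ceiling_le_iff le_floor_iff)
  then have fin: "finite X" by (rule finite_subset) simp
  define i0 where "i0 = Min X"
  have i0: "i0 \<in> X" "\<And>i. i \<in> X \<Longrightarrow> i0 \<le> i"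
    using False fin by (auto simp: i0_def)
  define t where "t = \<lfloor>(hi - lo) / q\<rfloor>"
  have t: "0 \<le> t" using assms by (simp add: t_def)
  have "card X \<le> card {0..t}"
  proof (rule card_inj_on_le[where f = "\<lambda>i. (i - i0) div q"])
    show "inj_on (\<lambda>i. (i - i0) div q) X"
      using assms(2)[OF _ i0(1)] by (auto simp: inj_on_def dvd_div_eq_iff)
    show "(\<lambda>i. (i - i0) div q) ` X \<subseteq> {0..t}"
    proof (rule image_subsetI)
      fix i assume i: "i \<in> X"
      then obtain k where k: "i - i0 = q * k" using assms(2)[OF _ i0(1)] by blast
      have "q * k \<ge> 0" using i0(2)[OF i] k by simp
      then have "k \<ge> 0" using assms(3) by (simp add: zero_le_mult_iff)
      have "real_of_int (i - i0) \<le> hi - lo"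
        using assms(1)[OF i] assms(1)[OF i0(1)] by simp
      then have "real_of_int k \<le> (hi - lo) / q"
        using k assms(3) by (simp add: field_simps)
      then have "k \<le> t" by (simp add: t_def le_floor_iff)
      with \<open>k \<ge> 0\<close> show "(i - i0) div q \<in> {0..t}" using k assms(3) by simp
    qed
  qed simp
  then have "real (card X) \<le> t + 1" using t by simp
  moreover have "real_of_int t \<le> (hi - lo) / q" by (simp add: t_def)
  ultimately show ?thesis using fin by simp
qed

section \<open>Forms of small discriminant take small values\<close>

text \<open>The triple \<open>(a, b, c)\<close> stands for the form \<open>a X\<^sup>2 + b X Z + c Z\<^sup>2\<close>. The bound on the
  discriminant is written as a square because \<open>S\<close> itself is the size of the small values and of the
  reduced coefficients below.\<close>
definition bounded_forms :: "real \<Rightarrow> real \<Rightarrow> (int \<times> int \<times> int) set" where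
  "bounded_forms Q S = {(a, b, c). real_of_int \<bar>a\<bar> \<le> Q \<and> real_of_int \<bar>b\<bar> \<le> Q \<and>
     real_of_int \<bar>c\<bar> \<le> Q \<and> real_of_int \<bar>b^2 - 4 * a * c\<bar> \<le> S^2}"

text \<open>Dirichlet's theorem is applied to \<open>- b/(2a)\<close> with a bound \<open>N\<close> on the denominator of
  order \<open>t = \<surd>(\<bar>a\<bar>/S)\<close>. This choice balances the two terms in \<open>4 a m = L\<^sup>2 - D y\<^sup>2\<close>:
  the first is at most \<open>4 a\<^sup>2/N\<^sup>2\<close>, the second at most \<open>S\<^sup>2 N\<^sup>2\<close>, and both become \<open>O(\<bar>a\<bar> S)\<close>.\<close>
lemma exists_small_value:
  fixes a b c :: int and Q S :: real
  assumes ca: "\<bar>c\<bar> \<le> \<bar>a\<bar>" and Sa: "S \<le> \<bar>a\<bar>" and aQ: "\<bar>a\<bar> \<le> Q" and S: "0 < S"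
    and disc: "real_of_int \<bar>b^2 - 4 * a * c\<bar> \<le> S^2"
  obtains x y :: int where "coprime x y" "1 \<le> y" "y \<le> 2 * sqrt (Q / S)" "\<bar>x\<bar> \<le> 3 * y"
    "\<bar>2 * a * x + b * y\<bar> \<le> 2 * sqrt (Q * S)" "\<bar>a * x^2 + b * x * y + c * y^2\<bar> \<le> 2 * S"
proof -
  define A where "A = real_of_int \<bar>a\<bar>"
  have A: "0 < A" "S \<le> A" "A \<le> Q" using Sa S aQ by (auto simp: A_def)
  define t where "t = sqrt (A / S)"
  have t1: "1 \<le> t" using A S by (simp add: t_def)
  have tt: "t^2 * S = A" using A S by (simp add: t_def)
  define N where "N = nat \<lceil>t\<rceil>"
  have N: "t \<le> N" "N \<le> 2 * t" "N > 0"
    using t1 unfolding N_def by linarith+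
  obtain x y where xy: "coprime x y" "0 < y" "y \<le> int N"
      and near: "\<bar>of_int y * (- b / (2 * a)) - of_int x\<bar> < 1 / N"
    using Dirichlet_approx_coprime[OF N(3), of "- b / (2 * a)"] by metis
  have a0: "a \<noteq> 0" using A by (auto simp: A_def)
  define L where "L = 2 * a * x + b * y"
  define m where "m = a * x^2 + b * x * y + c * y^2"
  have y1: "1 \<le> real_of_int y" using xy by simp
  have yN: "real_of_int y \<le> N" using xy(3) by (metis of_int_le_iff of_int_of_nat_eq)
  have "real_of_int L = - (2 * a) * (of_int y * (- b / (2 * a)) - of_int x)"
    using a0 by (simp add: L_def field_simps)
  then have "\<bar>real_of_int L\<bar> = 2 * A * \<bar>of_int y * (- b / (2 * a)) - of_int x\<bar>"
    by (simp only: abs_mult abs_minus_cancel A_def) (simp add: abs_mult)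
  also have "\<dots> \<le> 2 * A * (1 / t)"
  proof -
    have "1 / real N \<le> 1 / t" using N t1 by (intro divide_left_mono) auto
    then show ?thesis using near A by (intro mult_left_mono) auto
  qed
  also have "2 * A * (1 / t) = 2 * (t * S)"
    using t1 tt[symmetric] by (simp add: power2_eq_square)
  finally have L: "\<bar>real_of_int L\<bar> \<le> 2 * (t * S)" .
  have "(t * S)^2 = A * S" using tt by (simp add: power2_eq_square algebra_simps)
  then have L2: "(real_of_int L)^2 \<le> 4 * (A * S)"
    using power_mono[OF L abs_ge_zero, of 2] by (simp add: power_mult_distrib)
  have "t * S = sqrt (A * S)"
    using \<open>(t * S)^2 = A * S\<close> t1 S by (metis real_sqrt_unique mult_nonneg_nonneg less_imp_le order.trans zero_le_one)
  also have "\<dots> \<le> sqrt (Q * S)" using A S by simp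
  finally have LQ: "\<bar>real_of_int L\<bar> \<le> 2 * sqrt (Q * S)" using L by linarith
  have "y \<le> 2 * t" using yN N by linarith
  have "t \<le> sqrt (Q / S)" unfolding t_def using A S by (simp add: divide_right_mono)
  with \<open>y \<le> 2 * t\<close> have yQ: "y \<le> 2 * sqrt (Q / S)" by linarith
  have "4 * a * m = L^2 - (b^2 - 4 * a * c) * y^2"
    by (simp add: m_def L_def power2_eq_square algebra_simps)
  then have "4 * real_of_int a * m = (real_of_int L)^2 - real_of_int (b^2 - 4 * a * c) * (real_of_int y)^2"
    by (metis of_int_diff of_int_mult of_int_numeral of_int_power)
  then have "4 * A * \<bar>m\<bar> = \<bar>(real_of_int L)^2 - real_of_int (b^2 - 4 * a * c) * (real_of_int y)^2\<bar>"
    by (simp only: A_def of_int_abs) (metis abs_mult abs_numeral)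
  also have "\<dots> \<le> (real_of_int L)^2 + \<bar>real_of_int (b^2 - 4 * a * c) * (real_of_int y)^2\<bar>"
    using abs_triangle_ineq4[of "(real_of_int L)^2"] by simp
  also have "\<bar>real_of_int (b^2 - 4 * a * c) * (real_of_int y)^2\<bar> \<le> S^2 * (2 * t)^2"
    unfolding abs_mult using disc power_mono[of "real_of_int y" "2 * t" 2] \<open>y \<le> 2 * t\<close> y1
    by (intro mult_mono) auto
  also have "S^2 * (2 * t)^2 = 4 * (A * S)"
    using tt[symmetric] by (simp add: power2_eq_square algebra_simps)
  finally have "4 * A * \<bar>m\<bar> \<le> 4 * (A * S) + 4 * (A * S)" using L2 by linarith
  then have "A * real_of_int \<bar>m\<bar> \<le> A * (2 * S)" by argo
  then have m: "\<bar>m\<bar> \<le> 2 * S" using A by (simp only: mult_le_cancel_left_pos)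
  have "real_of_int b^2 \<le> 9 * A^2"
  proof -
    have "real_of_int b^2 \<le> S^2 + 4 * (real_of_int a * c)"
      using disc by (simp add: abs_le_iff algebra_simps)
    also have "real_of_int a * c \<le> A * A"
    proof -
      have "real_of_int a * c \<le> \<bar>real_of_int a\<bar> * \<bar>real_of_int c\<bar>"
        by (metis abs_ge_self abs_mult)
      also have "\<dots> \<le> A * A" using ca by (intro mult_mono) (auto simp: A_def simp flip: of_int_abs)
      finally show ?thesis .
    qed
    also have "S^2 \<le> A^2" using A S by (intro power_mono) auto
    finally show ?thesis using zero_le_power2[of A] unfolding power2_eq_square by linarith
  qed
  then have "\<bar>real_of_int b\<bar>^2 \<le> (3 * A)^2" by (simp add: power_mult_distrib)
  then have bA: "\<bar>real_of_int b\<bar> \<le> 3 * A" by (rule power2_le_imp_le) (use A in simp)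
  have "\<bar>real_of_int x\<bar> \<le> 3 * y"
  proof -
    have "2 * (real_of_int a * x) = L - b * real_of_int y" by (simp add: L_def)
    then have "\<bar>2 * (real_of_int a * x)\<bar> = \<bar>L - b * real_of_int y\<bar>" by (rule arg_cong)
    then have "2 * (A * \<bar>real_of_int x\<bar>) = \<bar>L - b * real_of_int y\<bar>"
      by (simp only: abs_mult abs_numeral A_def of_int_abs)
    moreover have "\<bar>L - b * real_of_int y\<bar> \<le> \<bar>real_of_int L\<bar> + \<bar>b * real_of_int y\<bar>"
      by (rule abs_triangle_ineq4)
    moreover have "\<bar>b * real_of_int y\<bar> \<le> 3 * A * y"
      unfolding abs_mult using bA y1 by (intro mult_mono) auto
    moreover have "\<bar>real_of_int L\<bar> \<le> 2 * (A * y)"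
    proof -
      have "t * S * 1 \<le> t * S * t" using t1 S by (intro mult_left_mono) auto
      then have "t * S \<le> A" using tt by (simp only: power2_eq_square mult_ac)
      moreover have "A * 1 \<le> A * y" using A y1 by (intro mult_left_mono) auto
      ultimately show ?thesis using L by linarith
    qed
    moreover have "0 \<le> A * y" using A y1 by simp
    ultimately have "A * \<bar>real_of_int x\<bar> \<le> A * (3 * real_of_int y)" by argo
    then show ?thesis using A by (simp only: mult_le_cancel_left_pos)
  qed
  then have "\<bar>x\<bar> \<le> 3 * y" by (metis of_int_abs of_int_le_iff of_int_mult of_int_numeral)
  then show thesis
    using that[of x y] xy yQ LQ m unfolding L_def m_def by simp
qed

section \<open>Counting the forms that take a given value at a given vector\<close>

text \<open>The possible leading coefficients of a form whose value at \<open>(x, y)\<close> is \<open>m\<close> and for which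
  \<open>2 a x + b y = L\<close>. The second condition bounds the discriminant, since \<open>L\<^sup>2 - 4 a m\<close> is the discriminant
  times \<open>y\<^sup>2\<close>. The third is integrality of \<open>c\<close>, since \<open>c y\<^sup>2 = a x\<^sup>2 - x L + m\<close>.\<close>
definition leading_coeffs :: "real \<Rightarrow> real \<Rightarrow> int \<Rightarrow> int \<Rightarrow> int \<Rightarrow> int \<Rightarrow> int set" where
  "leading_coeffs Q S x y m L = {a. real_of_int \<bar>a\<bar> \<le> Q \<and>
     real_of_int \<bar>L^2 - 4 * a * m\<bar> \<le> S^2 * (of_int y)^2 \<and> y^2 dvd a * x^2 - x * L + m}"

text \<open>As \<open>x\<close> is invertible modulo \<open>y\<^sup>2\<close>, integrality determines \<open>a\<close> modulo \<open>y\<^sup>2\<close>. The two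
  estimates come from the two intervals to which \<open>a\<close> is confined, one by the height and one by the
  discriminant.\<close>
lemma card_leading_coeffs_le:
  assumes "coprime x y" "1 \<le> y" "0 \<le> Q"
  shows "finite (leading_coeffs Q S x y m L)"
    and "card (leading_coeffs Q S x y m L) \<le> 1 + 2 * Q / (of_int y)^2"
    and "m \<noteq> 0 \<Longrightarrow> card (leading_coeffs Q S x y m L) \<le> 1 + S^2 / (2 * of_int \<bar>m\<bar>)"
proof -
  have dvd: "y^2 dvd i - j" if "i \<in> leading_coeffs Q S x y m L" "j \<in> leading_coeffs Q S x y m L" for i j
  proof -
    have "y^2 dvd (i * x^2 - x * L + m) - (j * x^2 - x * L + m)"
      using that by (intro dvd_diff[of "y^2" "i * x^2 - x * L + m" "j * x^2 - x * L + m"]) (simp_all add: leading_coeffs_def)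
    then have "y^2 dvd (i - j) * x^2" by (simp add: algebra_simps)
    moreover have "coprime (y^2) (x^2)" using assms(1) by (simp add: coprime_commute)
    ultimately show ?thesis by (simp add: coprime_dvd_mult_left_iff)
  qed
  have "finite (leading_coeffs Q S x y m L) \<and>
      card (leading_coeffs Q S x y m L) \<le> 1 + (Q - - Q) / real_of_int (y^2)"
  proof (rule card_spaced_le)
    fix a assume "a \<in> leading_coeffs Q S x y m L"
    then have "real_of_int \<bar>a\<bar> \<le> Q" by (simp add: leading_coeffs_def)
    then show "- Q \<le> a \<and> a \<le> Q" by linarith
  qed (use assms dvd in auto)
  then show "finite (leading_coeffs Q S x y m L)"
    and "card (leading_coeffs Q S x y m L) \<le> 1 + 2 * Q / (of_int y)^2" by auto
  assume m: "m \<noteq> 0"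
  \<comment> \<open>The discriminant confines \<open>a\<close> to the interval of radius \<open>r\<close> around \<open>z\<close>.\<close>
  define z where "z = (of_int L)^2 / (4 * real_of_int m)"
  define r where "r = S^2 * (of_int y)^2 / (4 * of_int \<bar>m\<bar>)"
  have r: "0 \<le> r" by (simp add: r_def)
  have "z - r \<le> a \<and> a \<le> z + r" if "a \<in> leading_coeffs Q S x y m L" for a
  proof -
    have "z - a = of_int (L^2 - 4 * a * m) / (4 * real_of_int m)"
      using m by (simp add: z_def field_simps)
    then have "\<bar>z - a\<bar> = of_int \<bar>L^2 - 4 * a * m\<bar> / (4 * of_int \<bar>m\<bar>)"
      by (simp add: abs_mult)
    also have "\<dots> \<le> r"
      using that unfolding r_def leading_coeffs_def by (intro divide_right_mono) auto
    finally show ?thesis by linarith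
  qed
  then have "finite (leading_coeffs Q S x y m L) \<and>
      card (leading_coeffs Q S x y m L) \<le> 1 + (z + r - (z - r)) / real_of_int (y^2)"
    using assms dvd r by (intro card_spaced_le) auto
  also have "(z + r - (z - r)) / real_of_int (y^2) = S^2 / (2 * of_int \<bar>m\<bar>)"
    using assms m by (simp add: r_def)
  finally show "card (leading_coeffs Q S x y m L) \<le> 1 + S^2 / (2 * of_int \<bar>m\<bar>)" by simp
qed

definition forms_with_value :: "real \<Rightarrow> real \<Rightarrow> int \<Rightarrow> int \<Rightarrow> int \<Rightarrow> (int \<times> int \<times> int) set" where
  "forms_with_value Q S x y m = {(a, b, c). (a, b, c) \<in> bounded_forms Q S \<and>
     a * x^2 + b * x * y + c * y^2 = m \<and> real_of_int \<bar>2 * a * x + b * y\<bar> \<le> 2 * sqrt (Q * S)}"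

lemma finite_bounded_forms: "finite (bounded_forms Q S)"
proof (rule finite_subset)
  show "bounded_forms Q S \<subseteq> {-\<lfloor>Q\<rfloor>..\<lfloor>Q\<rfloor>} \<times> {-\<lfloor>Q\<rfloor>..\<lfloor>Q\<rfloor>} \<times> {-\<lfloor>Q\<rfloor>..\<lfloor>Q\<rfloor>}"
    unfolding bounded_forms_def by clarsimp linarith
qed simp

lemma finite_forms_with_value: "finite (forms_with_value Q S x y m)"
  by (rule finite_subset[OF _ finite_bounded_forms]) (auto simp: forms_with_value_def)

text \<open>A form is recovered from \<open>L\<close> and its leading coefficient. Modulo \<open>y\<close> one has
  \<open>m = a x\<^sup>2\<close> and \<open>L = 2 a x\<close>, hence \<open>L x = 2 m\<close>, which determines \<open>L\<close> modulo \<open>y\<close>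
  as \<open>x\<close> is invertible.\<close>
lemma card_forms_with_value_le:
  fixes B K :: real
  assumes xy: "coprime x y" "1 \<le> y" and Q: "0 \<le> Q" and B: "0 \<le> B"
    and LB: "\<And>a b c. (a, b, c) \<in> forms_with_value Q S x y m \<Longrightarrow> real_of_int \<bar>2 * a * x + b * y\<bar> \<le> B"
    and K: "\<And>L. card (leading_coeffs Q S x y m L) \<le> K"
  shows "card (forms_with_value Q S x y m) \<le> (1 + 2 * B / y) * K"
proof -
  define Ls where "Ls = {L. real_of_int \<bar>L\<bar> \<le> B \<and> y dvd L * x - 2 * m}"
  have dvd: "y dvd i - j" if "i \<in> Ls" "j \<in> Ls" for i j
  proof -
    have "y dvd (i * x - 2 * m) - (j * x - 2 * m)"
      using that by (intro dvd_diff[of y "i * x - 2 * m" "j * x - 2 * m"]) (simp_all add: Ls_def)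
    then have "y dvd (i - j) * x" by (simp add: algebra_simps)
    then show ?thesis using xy(1) by (simp add: coprime_dvd_mult_left_iff coprime_commute)
  qed
  have Ls: "finite Ls \<and> card Ls \<le> 1 + (B - - B) / real_of_int y"
  proof (rule card_spaced_le)
    fix i assume "i \<in> Ls"
    then have "real_of_int \<bar>i\<bar> \<le> B" by (simp add: Ls_def)
    then show "- B \<le> i \<and> i \<le> B" by linarith
  qed (use xy B dvd in auto)
  \<comment> \<open>The form with leading coefficient \<open>a\<close>, derivative \<open>L\<close> and value \<open>m\<close> at \<open>(x, y)\<close>.\<close>
  define R where "R = (\<lambda>L a. (a, (L - 2 * a * x) div y, (a * x^2 - x * L + m) div y^2))"
  have sub: "forms_with_value Q S x y m \<subseteq> (\<Union>L\<in>Ls. R L ` leading_coeffs Q S x y m L)"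
  proof
    fix f assume f: "f \<in> forms_with_value Q S x y m"
    obtain a b c where abc: "f = (a, b, c)" by (metis prod_cases3)
    define L where "L = 2 * a * x + b * y"
    have m: "m = a * x^2 + b * x * y + c * y^2" and tr: "(a, b, c) \<in> bounded_forms Q S"
      using f by (auto simp: abc forms_with_value_def)
    have "L * x - 2 * m = y * (- b * x - 2 * c * y)"
      by (simp add: L_def m power2_eq_square algebra_simps)
    then have LLs: "L \<in> Ls" using LB f by (simp add: Ls_def L_def abc)
    have cy: "a * x^2 - x * L + m = y^2 * c"
      by (simp add: L_def m power2_eq_square algebra_simps)
    have "L^2 - 4 * a * m = (b^2 - 4 * a * c) * y^2"
      by (simp add: L_def m power2_eq_square algebra_simps)
    then have "real_of_int \<bar>L^2 - 4 * a * m\<bar> = real_of_int \<bar>b^2 - 4 * a * c\<bar> * (of_int y)^2"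
      by (simp add: abs_mult)
    also have "\<dots> \<le> S^2 * (of_int y)^2"
      using tr by (intro mult_right_mono) (auto simp: bounded_forms_def)
    finally have "a \<in> leading_coeffs Q S x y m L"
      using tr cy by (simp add: leading_coeffs_def bounded_forms_def)
    moreover have "f = R L a"
      unfolding R_def cy using xy(2) by (simp add: abc L_def)
    ultimately show "f \<in> (\<Union>L\<in>Ls. R L ` leading_coeffs Q S x y m L)" using LLs by blast
  qed
  have "card (forms_with_value Q S x y m) \<le> card (\<Union>L\<in>Ls. R L ` leading_coeffs Q S x y m L)"
    using Ls card_leading_coeffs_le(1)[OF xy Q] by (intro card_mono[OF _ sub]) auto
  also have "\<dots> \<le> (\<Sum>L\<in>Ls. card (R L ` leading_coeffs Q S x y m L))"
    using Ls by (intro card_UN_le) simp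
  also have "\<dots> \<le> (\<Sum>L\<in>Ls. card (leading_coeffs Q S x y m L))"
    by (intro sum_mono card_image_le card_leading_coeffs_le(1)[OF xy Q])
  finally have "real (card (forms_with_value Q S x y m)) \<le> real (\<Sum>L\<in>Ls. card (leading_coeffs Q S x y m L))"
    by (simp only: of_nat_le_iff)
  also have "\<dots> \<le> card Ls * K"
    unfolding of_nat_sum by (rule order.trans[OF sum_mono[OF K]]) simp
  also have "\<dots> \<le> (1 + 2 * B / y) * K"
  proof (rule mult_right_mono)
    show "0 \<le> K" using K[of 0] of_nat_0_le_iff order.trans by blast
  qed (use Ls in auto)
  finally show ?thesis .
qed

text \<open>The constraints on \<open>y\<close> and \<open>m\<close> make the intervals for \<open>L\<close> and for \<open>a\<close> at least
  comparable to their moduli, so that the summand \<open>1\<close> in each count is absorbed by the main term.\<close>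
lemma card_forms_with_nonzero_value_le:
  assumes xy: "coprime x y" "1 \<le> y" "y \<le> 2 * sqrt (Q / S)" and S: "1 \<le> S" "S \<le> Q"
    and m: "m \<noteq> 0" "real_of_int \<bar>m\<bar> \<le> 2 * S"
  shows "card (forms_with_value Q S x y m) \<le> 36 * sqrt (Q * S) / y * min (S^2 / of_int \<bar>m\<bar>) (Q / (of_int y)^2)"
proof -
  define Y where "Y = real_of_int y"
  define M where "M = real_of_int \<bar>m\<bar>"
  have Y: "1 \<le> Y" "Y \<le> 2 * sqrt (Q / S)" using xy by (auto simp: Y_def)
  have M: "1 \<le> M" "M \<le> 2 * S" using m by (auto simp: M_def)
  have "Y^2 \<le> (2 * sqrt (Q / S))^2" using Y by (intro power_mono) auto
  then have Y2: "Y^2 * S \<le> 4 * Q" using S by (simp add: power_mult_distrib field_simps)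
  moreover have "Y^2 * 1 \<le> Y^2 * S" using S by (intro mult_left_mono) auto
  ultimately have "Y^2 \<le> 4 * Q" by linarith
  then have k1: "1 \<le> 4 * (Q / Y^2)" using Y by (simp add: field_simps)
  have "2 * S * 1 \<le> 2 * S * S" using S by (intro mult_left_mono) auto
  then have "M \<le> 2 * S^2" using M unfolding power2_eq_square by linarith
  then have k2: "1 \<le> 2 * (S^2 / M)" using M by (simp add: field_simps)
  have "sqrt (Q * S) = sqrt (Q / S) * S"
    using S real_div_sqrt[of S] by (simp add: real_sqrt_mult real_sqrt_divide flip: times_divide_eq_right)
  then have "Y * S \<le> 2 * sqrt (Q * S)" using mult_right_mono[OF Y(2), of S] S by simp
  moreover have "Y * 1 \<le> Y * S" using Y S by (intro mult_left_mono) auto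
  ultimately have "Y \<le> 2 * sqrt (Q * S)" by linarith
  then have l: "1 \<le> 2 * (sqrt (Q * S) / Y)" using Y by (simp add: field_simps)
  have "card (forms_with_value Q S x y m) \<le> (1 + 2 * (2 * sqrt (Q * S)) / y) * (6 * min (S^2 / M) (Q / Y^2))"
  proof (rule card_forms_with_value_le)
    fix L
    have "card (leading_coeffs Q S x y m L) \<le> 1 + 2 * (Q / Y^2)"
      using card_leading_coeffs_le(2)[OF xy(1,2), of Q] S by (simp add: Y_def)
    moreover have "card (leading_coeffs Q S x y m L) \<le> 1 + S^2 / M / 2"
      using card_leading_coeffs_le(3)[OF xy(1,2) _ m(1), of Q] S by (simp add: M_def mult.commute)
    ultimately show "card (leading_coeffs Q S x y m L) \<le> 6 * min (S^2 / M) (Q / Y^2)"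
      using k1 k2 by (simp add: min_def)
  qed (use xy S in \<open>auto simp: forms_with_value_def\<close>)
  also have "\<dots> \<le> (6 * (sqrt (Q * S) / Y)) * (6 * min (S^2 / M) (Q / Y^2))"
    using l S M by (intro mult_right_mono) (auto simp: Y_def)
  finally show ?thesis by (simp add: Y_def M_def mult_ac)
qed

text \<open>If \<open>f(x, y) = 0\<close> then \<open>L\<^sup>2 = D y\<^sup>2\<close>, hence \<open>\<bar>L\<bar> \<le> S y\<close>. This replaces the generic bound
  on \<open>L\<close>, which would be too weak for small \<open>y\<close>, and makes up for the missing estimate on \<open>a\<close>
  from the discriminant.\<close>
lemma card_forms_with_value_zero_le:
  assumes xy: "coprime x y" "1 \<le> y" "y \<le> 2 * sqrt (Q / S)" and S: "1 \<le> S" "S \<le> Q"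
  shows "card (forms_with_value Q S x y 0) \<le> 18 * S * Q / (of_int y)^2"
proof -
  define Y where "Y = real_of_int y"
  have Y: "1 \<le> Y" "Y \<le> 2 * sqrt (Q / S)" using xy by (auto simp: Y_def)
  have "Y^2 \<le> (2 * sqrt (Q / S))^2" using Y by (intro power_mono) auto
  then have Y2: "Y^2 * S \<le> 4 * Q" using S by (simp add: power_mult_distrib field_simps)
  moreover have "Y^2 * 1 \<le> Y^2 * S" using S by (intro mult_left_mono) auto
  ultimately have "Y^2 \<le> 4 * Q" by linarith
  then have k1: "1 \<le> 4 * (Q / Y^2)" using Y by (simp add: field_simps)
  have "card (forms_with_value Q S x y 0) \<le> (1 + 2 * (S * Y) / y) * (6 * (Q / Y^2))"
  proof (rule card_forms_with_value_le)
    fix L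
    have "card (leading_coeffs Q S x y 0 L) \<le> 1 + 2 * (Q / Y^2)"
      using card_leading_coeffs_le(2)[OF xy(1,2), of Q] S by (simp add: Y_def)
    then show "card (leading_coeffs Q S x y 0 L) \<le> 6 * (Q / Y^2)"
      using k1 by linarith
  next
    fix a b c assume abc: "(a, b, c) \<in> forms_with_value Q S x y 0"
    define L where "L = 2 * a * x + b * y"
    have "L^2 = 4 * a * (a * x^2 + b * x * y + c * y^2) + (b^2 - 4 * a * c) * y^2"
      by (simp add: L_def power2_eq_square algebra_simps)
    then have "L^2 = (b^2 - 4 * a * c) * y^2" using abc by (simp add: forms_with_value_def)
    then have "real_of_int \<bar>L\<bar>^2 = real_of_int (b^2 - 4 * a * c) * Y^2"
      by (simp add: Y_def flip: of_int_power)
    also have "\<dots> \<le> S^2 * Y^2"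
      using abc by (intro mult_right_mono) (auto simp: forms_with_value_def bounded_forms_def)
    finally have "real_of_int \<bar>L\<bar>^2 \<le> (S * Y)^2" by (simp add: power_mult_distrib)
    moreover have "0 \<le> S * Y" using S Y by simp
    ultimately have "real_of_int \<bar>L\<bar> \<le> S * Y" by (rule power2_le_imp_le)
    then show "real_of_int \<bar>2 * a * x + b * y\<bar> \<le> S * Y" by (simp only: L_def)
  qed (use xy S Y in auto)
  also have "\<dots> \<le> (3 * S) * (6 * (Q / Y^2))"
    using S Y by (intro mult_right_mono) (auto simp: Y_def)
  finally show ?thesis by (simp add: Y_def)
qed

section \<open>The upper bound\<close>

lemma card_small_leading_forms_le:
  fixes Q S :: real
  assumes S: "1 \<le> S"
  shows "card {(a, b, c). (a, b, c) \<in> bounded_forms Q S \<and> \<bar>c\<bar> \<le> \<bar>a\<bar> \<and> real_of_int \<bar>a\<bar> < S} \<le> 63 * S^3"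
proof -
  define s where "s = \<lfloor>S\<rfloor>"
  define t where "t = \<lfloor>3 * S\<rfloor>"
  have "{(a, b, c). (a, b, c) \<in> bounded_forms Q S \<and> \<bar>c\<bar> \<le> \<bar>a\<bar> \<and> real_of_int \<bar>a\<bar> < S} \<subseteq> {-s..s} \<times> {-t..t} \<times> {-s..s}"
  proof
    fix f assume f: "f \<in> {(a, b, c). (a, b, c) \<in> bounded_forms Q S \<and> \<bar>c\<bar> \<le> \<bar>a\<bar> \<and> real_of_int \<bar>a\<bar> < S}"
    obtain a b c where f_eq: "f = (a, b, c)" by (metis prod_cases3)
    have abc: "(a, b, c) \<in> bounded_forms Q S" "\<bar>c\<bar> \<le> \<bar>a\<bar>" "real_of_int \<bar>a\<bar> < S"
      using f by (auto simp: f_eq)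
    have as: "\<bar>a\<bar> \<le> s" using abc(3) by (simp add: s_def le_floor_iff)
    have "real_of_int b^2 \<le> S^2 + 4 * (real_of_int a * c)"
      using abc(1) by (simp add: bounded_forms_def abs_le_iff algebra_simps)
    moreover have "real_of_int a * c \<le> S * S"
    proof -
      have "real_of_int a * c \<le> \<bar>real_of_int a\<bar> * \<bar>real_of_int c\<bar>"
        by (metis abs_ge_self abs_mult)
      also have "\<dots> \<le> S * S" using abc S by (intro mult_mono) linarith+
      finally show ?thesis .
    qed
    ultimately have "\<bar>real_of_int b\<bar>^2 \<le> (3 * S)^2"
      using zero_le_power2[of S] unfolding power_mult_distrib power2_abs power2_eq_square by linarith
    then have "\<bar>real_of_int b\<bar> \<le> 3 * S" by (rule power2_le_imp_le) (use S in simp)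
    then have "\<bar>b\<bar> \<le> t" by (simp add: t_def le_floor_iff)
    with as abc(2) show "f \<in> {-s..s} \<times> {-t..t} \<times> {-s..s}" by (auto simp: f_eq)
  qed
  then have "card {(a, b, c). (a, b, c) \<in> bounded_forms Q S \<and> \<bar>c\<bar> \<le> \<bar>a\<bar> \<and> real_of_int \<bar>a\<bar> < S} \<le>
      card ({-s..s} \<times> {-t..t} \<times> {-s..s})"
    by (intro card_mono) auto
  also have "real \<dots> = (2 * real_of_int s + 1) * ((2 * real_of_int t + 1) * (2 * real_of_int s + 1))"
    using S by (simp add: card_cartesian_product s_def t_def)
  also have "\<dots> \<le> (3 * S) * ((7 * S) * (3 * S))"
  proof -
    have st: "2 * real_of_int s + 1 \<le> 3 * S" "2 * real_of_int t + 1 \<le> 7 * S" "0 \<le> s" "0 \<le> t"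
      using S unfolding s_def t_def by linarith+
    then show ?thesis using S by (intro mult_mono) auto
  qed
  finally show ?thesis by (simp add: power3_eq_cube)
qed

lemma card_forms_with_abs_value_le:
  fixes K :: real
  assumes y: "1 \<le> y" and K: "0 \<le> K"
    and bound: "\<And>x s. coprime x y \<Longrightarrow> s \<in> {1, -1} \<Longrightarrow> card (forms_with_value Q S x y (s * m)) \<le> K"
  shows "card (\<Union>(x, s)\<in>{x \<in> {-3 * y..3 * y}. coprime x y} \<times> {1, -1}. forms_with_value Q S x y (s * m)) \<le> 14 * of_int y * K"
proof -
  let ?I = "{x \<in> {-3 * y..3 * y}. coprime x y} \<times> {1, -1::int}"
  have fin: "finite ?I"
    by (rule finite_subset[of _ "{-3 * y..3 * y} \<times> {1, -1}"]) auto
  have "card ?I \<le> card ({-3 * y..3 * y} \<times> {1, -1::int})"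
    by (intro card_mono) auto
  also have "\<dots> = nat (6 * y + 1) * 2" by (simp add: card_cartesian_product)
  finally have I: "real (card ?I) \<le> 14 * of_int y" using y by linarith
  have "card (\<Union>(x, s)\<in>?I. forms_with_value Q S x y (s * m)) \<le> (\<Sum>(x, s)\<in>?I. card (forms_with_value Q S x y (s * m)))"
    using card_UN_le[OF fin, of "\<lambda>(x, s). forms_with_value Q S x y (s * m)"] by (simp add: case_prod_unfold)
  then have "real (card (\<Union>(x, s)\<in>?I. forms_with_value Q S x y (s * m))) \<le>
      (\<Sum>z\<in>?I. real (card (forms_with_value Q S (fst z) y (snd z * m))))"
    by (simp add: case_prod_unfold flip: of_nat_sum)
  also have "\<dots> \<le> (\<Sum>z\<in>?I. K)"
  proof (rule sum_mono)
    fix z assume "z \<in> ?I"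
    then have "coprime (fst z) y" "snd z \<in> {1, -1}" by auto
    then show "real (card (forms_with_value Q S (fst z) y (snd z * m))) \<le> K" by (rule bound)
  qed
  also have "\<dots> = card ?I * K" by simp
  also have "\<dots> \<le> 14 * of_int y * K" using I K by (intro mult_right_mono)
  finally show ?thesis .
qed

text \<open>The forms are covered by those with small leading coefficient and by the cells
  \<open>(y, m)\<close>, where a cell collects the forms taking the value \<open>\<plusminus> m\<close> at some \<open>(x, y)\<close>. For \<open>m > 0\<close>
  the sum over \<open>y\<close> is taken first: up to a constant it turns the minimum into the geometric mean
  \<open>S \<surd>(Q/m)\<close> of \<open>S\<^sup>2/m\<close> and \<open>Q\<close>, and the remaining sum over \<open>m\<close> of \<open>1/\<surd>m\<close> is of order \<open>\<surd>S\<close>.\<close>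
lemma card_ordered_forms_le:
  fixes Q S :: real
  assumes S: "1 \<le> S" "S \<le> Q" and lnQ: "ln (2 * Q + 1) \<le> S"
  shows "card {(a, b, c). (a, b, c) \<in> bounded_forms Q S \<and> \<bar>c\<bar> \<le> \<bar>a\<bar>} \<le> 9000 * (Q * S^2)"
proof -
  define N where "N = \<lfloor>2 * sqrt (Q / S)\<rfloor>"
  define M where "M = \<lfloor>2 * S\<rfloor>"
  have N0: "0 \<le> N" and M0: "0 \<le> M" using S by (auto simp: N_def M_def)
  define X where "X = (\<lambda>y::int. {x \<in> {-3 * y..3 * y}. coprime x y} \<times> {1, -1::int})"
  define cell where "cell = (\<lambda>y m. \<Union>(x, s)\<in>X y. forms_with_value Q S x y (s * m))"
  define small where
    "small = {(a, b, c). (a, b, c) \<in> bounded_forms Q S \<and> \<bar>c\<bar> \<le> \<bar>a\<bar> \<and> real_of_int \<bar>a\<bar> < S}"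
  let ?H = "{(a, b, c). (a, b, c) \<in> bounded_forms Q S \<and> \<bar>c\<bar> \<le> \<bar>a\<bar>}"
  have cover: "?H \<subseteq> small \<union> (\<Union>y\<in>{1..N}. \<Union>m\<in>{0..M}. cell y m)"
  proof
    fix f assume f: "f \<in> ?H"
    obtain a b c where f_eq: "f = (a, b, c)" by (metis prod_cases3)
    have abc: "(a, b, c) \<in> bounded_forms Q S" "\<bar>c\<bar> \<le> \<bar>a\<bar>" using f by (auto simp: f_eq)
    have "real_of_int \<bar>a\<bar> < S" if not: "(a, b, c) \<notin> (\<Union>y\<in>{1..N}. \<Union>m\<in>{0..M}. cell y m)"
    proof (rule ccontr)
      assume "\<not> real_of_int \<bar>a\<bar> < S"
      then obtain x y where xy: "coprime x y" "1 \<le> y" "y \<le> 2 * sqrt (Q / S)" "\<bar>x\<bar> \<le> 3 * y"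
          "\<bar>2 * a * x + b * y\<bar> \<le> 2 * sqrt (Q * S)" "\<bar>a * x^2 + b * x * y + c * y^2\<bar> \<le> 2 * S"
        using exists_small_value[of c a S Q b] abc S by (auto simp: bounded_forms_def)
      define m where "m = \<bar>a * x^2 + b * x * y + c * y^2\<bar>"
      define s :: int where "s = (if a * x^2 + b * x * y + c * y^2 \<ge> 0 then 1 else -1)"
      have "y \<in> {1..N}" using xy(2,3) by (simp add: N_def le_floor_iff)
      moreover have "m \<in> {0..M}" using xy(6) by (simp add: m_def M_def le_floor_iff)
      moreover have "(x, s) \<in> X y" using xy(1,4) by (auto simp: X_def s_def)
      moreover have "(a, b, c) \<in> forms_with_value Q S x y (s * m)"
        using abc(1) xy(5) by (auto simp: forms_with_value_def s_def m_def)
      ultimately show False using not unfolding cell_def by blast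
    qed
    with abc show "f \<in> small \<union> (\<Union>y\<in>{1..N}. \<Union>m\<in>{0..M}. cell y m)"
      unfolding f_eq small_def by blast
  qed
  have cell0: "card (cell y 0) \<le> 252 * (S * Q) * (1 / y)" if y: "y \<in> {1..N}" for y
  proof -
    have y1: "1 \<le> y" "y \<le> 2 * sqrt (Q / S)" using y by (auto simp: N_def le_floor_iff)
    have "card (cell y 0) \<le> 14 * of_int y * (18 * S * Q / (of_int y)^2)"
      unfolding cell_def X_def
      by (rule card_forms_with_abs_value_le) (use y1 S card_forms_with_value_zero_le[OF _ y1 S] in auto)
    also have "\<dots> = 252 * (S * Q) * (1 / y)" using y1 by (simp add: power2_eq_square)
    finally show ?thesis .
  qed
  have cellm: "card (cell y m) \<le> 504 * sqrt (Q * S) * min (S^2 / m) (Q / (of_int y)^2)"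
    if y: "y \<in> {1..N}" and m: "m \<in> {1..M}" for y m
  proof -
    have y1: "1 \<le> y" "y \<le> 2 * sqrt (Q / S)" using y by (auto simp: N_def le_floor_iff)
    have m1: "1 \<le> m" "m \<le> 2 * S" using m by (auto simp: M_def le_floor_iff)
    have "card (cell y m) \<le> 14 * of_int y * (36 * sqrt (Q * S) / of_int y * min (S^2 / m) (Q / (of_int y)^2))"
      unfolding cell_def X_def
    proof (rule card_forms_with_abs_value_le)
      fix x s :: int assume x: "coprime x y" and s: "s \<in> {1, -1}"
      then have "s * m \<noteq> 0" "\<bar>s * m\<bar> = m" using m1 by auto
      then show "card (forms_with_value Q S x y (s * m)) \<le> 36 * sqrt (Q * S) / of_int y * min (S^2 / m) (Q / (of_int y)^2)"
        using card_forms_with_nonzero_value_le[OF x y1 S, of "s * m"] m1 by simp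
    qed (use y1 m1 S in auto)
    also have "\<dots> = 504 * sqrt (Q * S) * min (S^2 / m) (Q / (of_int y)^2)"
      using y1 by simp
    finally show ?thesis .
  qed
  have zero: "(\<Sum>y\<in>{1..N}. real (card (cell y 0))) \<le> 504 * (Q * S^2)"
  proof -
    have "Q / S \<le> Q * 1" using S by (simp add: divide_le_eq mult_le_cancel_left1)
    also have "\<dots> \<le> Q * Q" using S by (intro mult_left_mono) auto
    finally have "sqrt (Q / S) \<le> Q" using S by (intro real_le_lsqrt) (auto simp: power2_eq_square)
    moreover have "N \<le> 2 * sqrt (Q / S)" by (simp add: N_def)
    ultimately have "real_of_int N + 1 \<le> 2 * Q + 1" by linarith
    then have "ln (real_of_int N + 1) \<le> ln (2 * Q + 1)" using N0 by simp
    with lnQ have lnN: "ln (real_of_int N + 1) \<le> S" by linarith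
    have "(\<Sum>y\<in>{1..N}. real (card (cell y 0))) \<le> (\<Sum>y\<in>{1..N}. 252 * (S * Q) * (1 / y))"
      by (intro sum_mono cell0)
    also have "\<dots> = 252 * (S * Q) * (\<Sum>y\<in>{1..N}. 1 / y)"
      by (simp only: sum_distrib_left)
    also have "\<dots> \<le> 252 * (S * Q) * (2 * S)"
    proof (rule mult_left_mono)
      show "(\<Sum>y\<in>{1..N}. 1 / real_of_int y) \<le> 2 * S"
        using sum_inverse_le_ln[OF N0] lnN by simp
    qed (use S in simp)
    finally show ?thesis by (simp add: power2_eq_square mult_ac)
  qed
  have nonzero: "(\<Sum>y\<in>{1..N}. \<Sum>m\<in>{1..M}. real (card (cell y m))) \<le> 8064 * (Q * S^2)"
  proof -
    have "(\<Sum>y\<in>{1..N}. \<Sum>m\<in>{1..M}. real (card (cell y m))) \<le>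
        (\<Sum>y\<in>{1..N}. \<Sum>m\<in>{1..M}. 504 * sqrt (Q * S) * min (S^2 / m) (Q / (of_int y)^2))"
      by (intro sum_mono cellm)
    also have "\<dots> = 504 * sqrt (Q * S) * (\<Sum>m\<in>{1..M}. \<Sum>y\<in>{1..N}. min (S^2 / m) (Q / (of_int y)^2))"
      by (subst sum.swap) (simp only: sum_distrib_left)
    also have "\<dots> \<le> 504 * sqrt (Q * S) * (\<Sum>m\<in>{1..M}. 4 * (S * sqrt Q) * (1 / sqrt m))"
    proof (intro mult_left_mono sum_mono)
      fix m assume "m \<in> {1..M}"
      then have m: "0 < real_of_int m" by simp
      have "(\<Sum>y\<in>{1..N}. min (S^2 / m) (Q / (of_int y)^2)) \<le> 4 * sqrt (S^2 / m * Q)"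
        using S m by (intro sum_min_inverse_square_le N0) auto
      also have "\<dots> = 4 * (S * sqrt Q) * (1 / sqrt m)"
        using S by (simp add: real_sqrt_mult real_sqrt_divide)
      finally show "(\<Sum>y\<in>{1..N}. min (S^2 / m) (Q / (of_int y)^2)) \<le> 4 * (S * sqrt Q) * (1 / sqrt m)" .
    qed (use S in simp)
    also have "\<dots> = 2016 * sqrt (Q * S) * (S * sqrt Q) * (\<Sum>m\<in>{1..M}. 1 / sqrt m)"
      by (subst sum_distrib_left[symmetric]) simp
    also have "\<dots> \<le> 2016 * sqrt (Q * S) * (S * sqrt Q) * (2 * (2 * sqrt S))"
    proof (rule mult_left_mono)
      have "real_of_int M \<le> 4 * S" using S unfolding M_def by linarith
      then have "sqrt M \<le> sqrt (4 * S)" by simp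
      then have "sqrt M \<le> 2 * sqrt S" by (simp add: real_sqrt_mult)
      then show "(\<Sum>m\<in>{1..M}. 1 / sqrt m) \<le> 2 * (2 * sqrt S)"
        using sum_inverse_sqrt_le[OF M0] by linarith
    qed (use S in simp)
    also have "\<dots> = 8064 * (sqrt (Q * S) * sqrt (Q * S)) * S"
      by (simp add: real_sqrt_mult mult_ac)
    finally show ?thesis using S by (simp add: power2_eq_square mult_ac)
  qed
  have fin_small: "finite small"
    by (rule finite_subset[OF _ finite_bounded_forms[of Q S]]) (auto simp: small_def)
  have "finite (X y)" for y
    unfolding X_def by (rule finite_subset[of _ "{-3 * y..3 * y} \<times> {1, -1}"]) auto
  then have fin_cell: "finite (cell y m)" for y m
    unfolding cell_def by (auto simp: finite_forms_with_value)
  have "card ?H \<le> card (small \<union> (\<Union>y\<in>{1..N}. \<Union>m\<in>{0..M}. cell y m))"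
    using fin_small fin_cell by (intro card_mono[OF _ cover]) auto
  also have "\<dots> \<le> card small + card (\<Union>y\<in>{1..N}. \<Union>m\<in>{0..M}. cell y m)"
    by (rule card_Un_le)
  also have "card (\<Union>y\<in>{1..N}. \<Union>m\<in>{0..M}. cell y m) \<le> (\<Sum>y\<in>{1..N}. card (\<Union>m\<in>{0..M}. cell y m))"
    by (rule card_UN_le) simp
  also have "\<dots> \<le> (\<Sum>y\<in>{1..N}. \<Sum>m\<in>{0..M}. card (cell y m))"
    by (intro sum_mono card_UN_le) simp
  also have "\<dots> = (\<Sum>y\<in>{1..N}. card (cell y 0) + (\<Sum>m\<in>{1..M}. card (cell y m)))"
  proof -
    have "{0..M} = insert 0 {1..M}" using M0 by auto
    then show ?thesis by simp
  qed
  finally have "real (card ?H) \<le> real (card small + (\<Sum>y\<in>{1..N}. card (cell y 0) + (\<Sum>m\<in>{1..M}. card (cell y m))))"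
    by (simp only: of_nat_le_iff add_left_mono)
  also have "\<dots> = card small + ((\<Sum>y\<in>{1..N}. real (card (cell y 0))) +
      (\<Sum>y\<in>{1..N}. \<Sum>m\<in>{1..M}. real (card (cell y m))))"
    by (simp add: sum.distrib)
  also have "\<dots> \<le> 63 * (Q * S^2) + (504 * (Q * S^2) + 8064 * (Q * S^2))"
  proof (intro add_mono zero nonzero)
    have "real (card small) \<le> 63 * (S * S^2)"
      using card_small_leading_forms_le[OF S(1), of Q] by (simp add: small_def power3_eq_cube power2_eq_square)
    also have "\<dots> \<le> 63 * (Q * S^2)" using S by (intro mult_left_mono mult_right_mono) auto
    finally show "real (card small) \<le> 63 * (Q * S^2)" .
  qed
  also have "\<dots> \<le> 9000 * (Q * S^2)" using S by simp
  finally show ?thesis .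
qed

lemma card_bounded_forms_le:
  fixes Q S :: real
  assumes S: "1 \<le> S" "S \<le> Q" and lnQ: "ln (2 * Q + 1) \<le> S"
  shows "card (bounded_forms Q S) \<le> 18000 * (Q * S^2)"
proof -
  let ?H = "{(a, b, c). (a, b, c) \<in> bounded_forms Q S \<and> \<bar>c\<bar> \<le> \<bar>a\<bar>}"
  let ?swap = "\<lambda>(a, b, c). (c, b, a)"
  have sub: "bounded_forms Q S \<subseteq> ?H \<union> ?swap ` ?H"
  proof
    fix f assume f: "f \<in> bounded_forms Q S"
    obtain a b c where f_eq: "f = (a, b, c)" by (metis prod_cases3)
    have "(c, b, a) \<in> bounded_forms Q S" using f by (simp add: f_eq bounded_forms_def mult_ac)
    moreover have "f = ?swap (c, b, a)" by (simp add: f_eq)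
    ultimately show "f \<in> ?H \<union> ?swap ` ?H"
      using f by (cases "\<bar>c\<bar> \<le> \<bar>a\<bar>") (force simp: f_eq)+
  qed
  have fin: "finite ?H" by (rule finite_subset[OF _ finite_bounded_forms[of Q S]]) auto
  have "card (bounded_forms Q S) \<le> card (?H \<union> ?swap ` ?H)"
    using fin by (intro card_mono[OF _ sub]) auto
  also have "\<dots> \<le> card ?H + card ?H"
    by (rule order.trans[OF card_Un_le add_left_mono[OF card_image_le[OF fin]]])
  finally show ?thesis
    using card_ordered_forms_le[OF assms] by linarith
qed

section \<open>Primitive vectors and reduced forms\<close>

text \<open>A pair that is not coprime consists of two multiples of some \<open>d + 1 \<ge> 2\<close>. The union bound
  suffices because the sum of \<open>1/(d + 1)\<^sup>2\<close> over \<open>d \<ge> 1\<close> is at most \<open>2/3\<close>, by comparison with the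
  telescoping series of \<open>1/((d + 1/2) (d + 3/2))\<close>.\<close>
lemma card_coprime_pairs_ge:
  fixes N :: int
  assumes "0 \<le> N"
  shows "N^2 / 3 \<le> card {(x, y). x \<in> {1..N} \<and> y \<in> {1..N} \<and> coprime x y}"
proof -
  let ?C = "{(x, y). x \<in> {1..N} \<and> y \<in> {1..N} \<and> coprime x y}"
  define T where "T = (\<lambda>d. (\<lambda>k. (d + 1) * k) ` {1..N div (d + 1)})"
  have sub: "{1..N} \<times> {1..N} \<subseteq> ?C \<union> (\<Union>d\<in>{1..N}. T d \<times> T d)"
  proof
    fix z assume z: "z \<in> {1..N} \<times> {1..N}"
    obtain x y where z_eq: "z = (x, y)" by fastforce
    have x: "x \<in> {1..N}" and y: "y \<in> {1..N}" using z by (auto simp: z_eq)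
    have "coprime x y" if not: "(x, y) \<notin> (\<Union>d\<in>{1..N}. T d \<times> T d)"
    proof (rule ccontr)
      assume nc: "\<not> coprime x y"
      define d where "d = gcd x y - 1"
      have "gcd x y > 0" "x \<le> N" using x by simp_all
      moreover have "gcd x y \<noteq> 1" using nc by (simp add: coprime_iff_gcd_eq_1)
      moreover have "gcd x y \<le> x" using x by (intro zdvd_imp_le) auto
      ultimately have d: "d \<in> {1..N}" unfolding d_def atLeastAtMost_iff by presburger
      have "z \<in> T d" if z: "z \<in> {1..N}" "d + 1 dvd z" for z
      proof -
        obtain k where k: "z = (d + 1) * k" using z(2) by blast
        have "0 < (d + 1) * k" using z(1) k by simp
        then have "1 \<le> k" using d by (simp add: zero_less_mult_iff)
        moreover have "k \<le> N div (d + 1)"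
          using z(1) d k by (metis atLeastAtMost_iff zdiv_mono1 nonzero_mult_div_cancel_left add_pos_pos zero_less_one int_one_le_iff_zero_less order_less_imp_not_eq2)
        ultimately show ?thesis using k by (auto simp: T_def)
      qed
      then have "x \<in> T d" "y \<in> T d" using x y by (auto simp: d_def)
      with d not show False by blast
    qed
    with x y show "z \<in> ?C \<union> (\<Union>d\<in>{1..N}. T d \<times> T d)" unfolding z_eq by blast
  qed
  have Tcard: "real (card (T d)) \<le> N / (d + 1)" if "d \<in> {1..N}" for d
  proof -
    have "real (card (T d)) \<le> card {1..N div (d + 1)}"
      unfolding T_def of_nat_le_iff by (intro card_image_le) simp
    also have "\<dots> = real_of_int (N div (d + 1))" using assms that by (simp add: pos_imp_zdiv_nonneg_iff)
    also have "\<dots> \<le> real_of_int N / real_of_int (d + 1)"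
      by (rule real_of_int_div4)
    finally show ?thesis by simp
  qed
  have fin: "finite ?C" by (rule finite_subset[of _ "{1..N} \<times> {1..N}"]) auto
  have "card ({1..N} \<times> {1..N}) \<le> card (?C \<union> (\<Union>d\<in>{1..N}. T d \<times> T d))"
    using fin by (intro card_mono[OF _ sub]) (auto simp: T_def)
  also have "\<dots> \<le> card ?C + card (\<Union>d\<in>{1..N}. T d \<times> T d)" by (rule card_Un_le)
  also have "card (\<Union>d\<in>{1..N}. T d \<times> T d) \<le> (\<Sum>d\<in>{1..N}. card (T d \<times> T d))"
    by (rule card_UN_le) simp
  finally have "real (card ({1..N} \<times> {1..N})) \<le> real (card ?C + (\<Sum>d\<in>{1..N}. card (T d \<times> T d)))"
    by (simp only: of_nat_le_iff add_left_mono)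
  then have "(real_of_int N)^2 \<le> card ?C + (\<Sum>d\<in>{1..N}. (real (card (T d)))^2)"
    using assms by (simp add: card_cartesian_product power2_eq_square)
  also have "(\<Sum>d\<in>{1..N}. (real (card (T d)))^2) \<le> (\<Sum>d\<in>{1..N}. N^2 * (1 / (of_int d + 1)^2))"
  proof (rule sum_mono)
    fix d assume d: "d \<in> {1..N}"
    have "(real (card (T d)))^2 \<le> (N / (d + 1))^2" using Tcard[OF d] by (intro power_mono) auto
    then show "(real (card (T d)))^2 \<le> N^2 * (1 / (of_int d + 1)^2)"
      by (simp add: power_divide)
  qed
  also have "\<dots> = N^2 * (\<Sum>d\<in>{1..N}. 1 / (of_int d + 1)^2)"
    by (simp only: sum_distrib_left)
  also have "\<dots> \<le> N^2 * (2 / 3)"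
  proof (rule mult_left_mono)
    define G where "G = (\<lambda>d::int. - 1 / (real_of_int d + 3 / 2))"
    have "(\<Sum>d\<in>{1..N}. 1 / (real_of_int d + 1)^2) \<le> G N - G 0"
    proof (rule sum_le_telescope[OF assms])
      fix d :: int assume "1 \<le> d"
      then have d: "1 \<le> real_of_int d" by simp
      have "G d - G (d - 1) = 1 / ((d + 1 / 2) * (d + 3 / 2))"
        using d by (simp add: G_def divide_simps)
      moreover have "1 / (real_of_int d + 1)^2 \<le> 1 / ((d + 1 / 2) * (d + 3 / 2))"
        using d unfolding power2_eq_square
        by (intro divide_left_mono mult_pos_pos) (auto simp: algebra_simps)
      ultimately show "1 / (real_of_int d + 1)^2 \<le> G d - G (d - 1)" by simp
    qed
    also have "\<dots> \<le> 2 / 3" using assms by (simp add: G_def)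
    finally show "(\<Sum>d\<in>{1..N}. 1 / (real_of_int d + 1)^2) \<le> 2 / 3" .
  qed simp
  finally show ?thesis by simp
qed

text \<open>Completes a primitive vector to a unimodular matrix without increasing the size of the entries,
  so that the change of variables controls the height.\<close>
lemma bezout_box:
  fixes x y :: int
  assumes "coprime x y" "1 \<le> x" "1 \<le> y"
  obtains u w where "x * w - u * y = 1" "0 \<le> u" "u \<le> x" "0 \<le> w" "w \<le> y"
proof -
  obtain p q where pq: "p * x + q * y = 1"
    using bezout_int[of x y] assms(1) by (auto simp: coprime_iff_gcd_eq_1)
  define w where "w = 1 + (p - 1) mod y"
  define t where "t = (p - 1) div y"
  have w: "1 \<le> w" "w \<le> y"
    using assms(3) pos_mod_bound[of y "p - 1"] pos_mod_sign[of y "p - 1"] unfolding w_def by linarith+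
  have "p = w + y * t" by (simp add: w_def t_def algebra_simps)
  then have eq: "x * w - (- q - t * x) * y = 1" using pq by (simp add: algebra_simps)
  define u where "u = - q - t * x"
  have uy: "u * y = x * w - 1" using eq by (simp add: u_def)
  have "0 < x * w" using assms w by simp
  then have "0 \<le> u * y" using uy by simp
  then have u0: "0 \<le> u" using assms by (simp add: zero_le_mult_iff)
  have "x * w \<le> x * y" using assms w by (intro mult_left_mono) auto
  then have "u * y \<le> x * y" using uy by simp
  then have "u \<le> x" using assms by simp
  then show thesis using that[of w u] eq u0 w by (simp add: u_def)
qed

text \<open>Adding the nonnegative term \<open>n (X + Z)\<^sup>2\<close> removes the mixed term from twice the form and leaves
  \<open>(2 m - n) X\<^sup>2 + (2 k - n) Z\<^sup>2\<close> as a lower bound; for \<open>X, Z \<noteq> 0\<close> this exceeds \<open>2 m\<close>.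
  For \<open>X = 0 \<noteq> Z\<close> the value is at least \<open>k > m\<close>.\<close>
lemma reduced_form_min:
  fixes n m k X Z :: int
  assumes "0 < n" "n < m" "m < k" and "m * X^2 + n * X * Z + k * Z^2 \<le> m"
  shows "Z = 0"
proof (rule ccontr)
  assume "Z \<noteq> 0"
  then have Z: "1 \<le> Z^2" by (simp add: int_one_le_iff_zero_less)
  have "0 \<le> n * (X + Z)^2" using assms by simp
  then have *: "(2 * m - n) * X^2 + (2 * k - n) * Z^2 \<le> 2 * m"
    using assms(4) by (simp add: power2_eq_square algebra_simps)
  have "(2 * k - n) * 1 \<le> (2 * k - n) * Z^2" using assms Z by (intro mult_left_mono) auto
  show False
  proof (cases "X = 0")
    case True
    have "k * 1 \<le> k * Z^2" using assms Z by (intro mult_left_mono) auto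
    moreover have "k * Z^2 \<le> m" using True assms(4) by simp
    ultimately show False using assms(3) by linarith
  next
    case False
    then have "1 \<le> X^2" by (simp add: int_one_le_iff_zero_less)
    then have "(2 * m - n) * 1 \<le> (2 * m - n) * X^2" using assms by (intro mult_left_mono) auto
    define p q where "p = (2 * m - n) * X^2" and "q = (2 * k - n) * Z^2"
    have "p + q \<le> 2 * m" "2 * k - n \<le> q" "2 * m - n \<le> p"
      using * \<open>(2 * k - n) * 1 \<le> (2 * k - n) * Z^2\<close> \<open>(2 * m - n) * 1 \<le> (2 * m - n) * X^2\<close>
      by (simp_all only: p_def q_def mult_1_right)
    then show False using assms(2,3) by linarith
  qed
qed

lemma coprime_parallel_eq:
  fixes x y x' y' :: int
  assumes "coprime x y" "coprime x' y'" "1 \<le> x" "1 \<le> y" "1 \<le> x'" "1 \<le> y'" "x * y' = y * x'"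
  shows "x = x' \<and> y = y'"
proof -
  have "x dvd y * x'" by (metis assms(7) dvd_triv_left)
  then have "x dvd x'" using assms(1) by (simp add: coprime_dvd_mult_right_iff)
  moreover have "x' dvd x * y'" by (metis assms(7) dvd_triv_right)
  then have "x' dvd x" using assms(2) by (simp add: coprime_dvd_mult_left_iff)
  ultimately have "x = x'" using assms by (simp add: zdvd_antisym_nonneg)
  then show ?thesis using assms by simp
qed

section \<open>The lower bound\<close>

text \<open>The form \<open>m X\<^sup>2 + n X Z + k Z\<^sup>2\<close> after the substitution that sends the basis \<open>(x, y)\<close>,
  \<open>(u, w)\<close> of the lattice to the standard basis: it takes the values \<open>m\<close> at \<open>(x, y)\<close> and \<open>k\<close> at
  \<open>(u, w)\<close>, provided \<open>x w - u y = 1\<close>.\<close>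
definition transform :: "int \<Rightarrow> int \<Rightarrow> int \<Rightarrow> int \<Rightarrow> int \<Rightarrow> int \<Rightarrow> int \<Rightarrow> int \<times> int \<times> int" where
  "transform x y u w n m k = (m * w^2 - n * w * y + k * y^2,
     - 2 * m * u * w + n * (w * x + u * y) - 2 * k * x * y, m * u^2 - n * u * x + k * x^2)"

lemma transform_value:
  assumes "transform x y u w n m k = (a, b, c)"
  shows "a * p^2 + b * p * q + c * q^2 =
    m * (w * p - u * q)^2 + n * (w * p - u * q) * (x * q - y * p) + k * (x * q - y * p)^2"
proof -
  have eqs: "a = m * w^2 - n * w * y + k * y^2"
    "b = - 2 * m * u * w + n * (w * x + u * y) - 2 * k * x * y"
    "c = m * u^2 - n * u * x + k * x^2"
    using assms by (simp_all add: transform_def)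
  show ?thesis unfolding eqs by (simp add: power2_eq_square algebra_simps)
qed

lemma transform_discr:
  assumes "transform x y u w n m k = (a, b, c)" "x * w - u * y = 1"
  shows "b^2 - 4 * a * c = n^2 - 4 * m * k"
proof -
  have eqs: "a = m * w^2 - n * w * y + k * y^2"
    "b = - 2 * m * u * w + n * (w * x + u * y) - 2 * k * x * y"
    "c = m * u^2 - n * u * x + k * x^2"
    using assms by (simp_all add: transform_def)
  have "b^2 - 4 * a * c = (n^2 - 4 * m * k) * (x * w - u * y)^2"
    unfolding eqs by (simp add: power2_eq_square algebra_simps)
  then show ?thesis using assms(2) by simp
qed

text \<open>The three coefficients are read off from the values at \<open>(x, y)\<close>, \<open>(u, w)\<close> and their sum.\<close>
lemma transform_inj:
  assumes eq: "transform x y u w n m k = transform x y u w n' m' k'" and det: "x * w - u * y = 1"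
  shows "n = n' \<and> m = m' \<and> k = k'"
proof -
  obtain a b c where abc: "transform x y u w n m k = (a, b, c)" by (metis prod_cases3)
  note abc' = abc[unfolded eq]
  have det': "w * x - u * y = 1" "x * y - y * x = 0" "w * u - u * w = 0" "x * w - y * u = 1"
    "w * (x + u) - u * (y + w) = 1" "x * (y + w) - y * (x + u) = 1"
    using det by (simp_all add: algebra_simps)
  have "m = m'" using transform_value[OF abc, of x y] transform_value[OF abc', of x y] det' by simp
  moreover have "k = k'"
    using transform_value[OF abc, of u w] transform_value[OF abc', of u w] det' by simp
  moreover have "m + n + k = m' + n' + k'"
    using transform_value[OF abc, of "x + u" "y + w"] transform_value[OF abc', of "x + u" "y + w"] det'
    by simp
  ultimately show ?thesis by simp
qed

lemma transform_height:
  assumes "transform x y u w n m k = (a, b, c)"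
    and "0 \<le> x" "x \<le> N" "0 \<le> y" "y \<le> N" "0 \<le> u" "u \<le> N" "0 \<le> w" "w \<le> N" "0 \<le> n" "0 \<le> m" "0 \<le> k"
  shows "\<bar>a\<bar> \<le> 2 * (m + n + k) * N^2 \<and> \<bar>b\<bar> \<le> 2 * (m + n + k) * N^2 \<and> \<bar>c\<bar> \<le> 2 * (m + n + k) * N^2"
proof -
  have P: "0 \<le> j * (p * q) \<and> j * (p * q) \<le> j * N^2"
    if "0 \<le> j" "0 \<le> p" "p \<le> N" "0 \<le> q" "q \<le> N" for j p q
    using that by (auto simp: power2_eq_square intro!: mult_left_mono mult_mono)
  have B: "0 \<le> m * (w * w) \<and> m * (w * w) \<le> m * N^2" "0 \<le> n * (w * y) \<and> n * (w * y) \<le> n * N^2"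
    "0 \<le> k * (y * y) \<and> k * (y * y) \<le> k * N^2" "0 \<le> m * (u * w) \<and> m * (u * w) \<le> m * N^2"
    "0 \<le> n * (w * x) \<and> n * (w * x) \<le> n * N^2" "0 \<le> n * (u * y) \<and> n * (u * y) \<le> n * N^2"
    "0 \<le> k * (x * y) \<and> k * (x * y) \<le> k * N^2" "0 \<le> m * (u * u) \<and> m * (u * u) \<le> m * N^2"
    "0 \<le> n * (u * x) \<and> n * (u * x) \<le> n * N^2" "0 \<le> k * (x * x) \<and> k * (x * x) \<le> k * N^2"
    by (rule P; rule assms)+
  have "a = m * (w * w) - n * (w * y) + k * (y * y)"
    "b = - 2 * (m * (u * w)) + n * (w * x) + n * (u * y) - 2 * (k * (x * y))"
    "c = m * (u * u) - n * (u * x) + k * (x * x)"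
    using assms(1) by (auto simp: transform_def power2_eq_square algebra_simps)
  moreover have "2 * (m + n + k) * N^2 = 2 * (m * N^2) + 2 * (n * N^2) + 2 * (k * N^2)"
    by (simp add: algebra_simps)
  moreover have "0 \<le> m * N^2" "0 \<le> n * N^2" "0 \<le> k * N^2" using assms by auto
  ultimately show ?thesis using B by linarith
qed

definition nondegenerate_forms :: "real \<Rightarrow> real \<Rightarrow> (int \<times> int \<times> int) set" where
  "nondegenerate_forms Q S = {(a, b, c). (a, b, c) \<in> bounded_forms Q S \<and> a \<noteq> 0 \<and> b^2 - 4 * a * c \<noteq> 0}"

text \<open>The three ranges for \<open>n\<close>, \<open>m\<close>, \<open>k\<close> are consecutive intervals of length \<open>M\<close>, which forces
  \<open>n < m < k\<close>, while \<open>4 m k - n\<^sup>2\<close> stays positive and below \<open>25 M\<^sup>2\<close>. If two choices give the same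
  form, compare the two minima: the vector belonging to the smaller one is, for the other
  choice, a vector of value at most its own minimum, so that by reducedness the two primitive vectors
  are parallel and hence equal.\<close>
lemma card_nondegenerate_ge_box:
  fixes Q S :: real and M N :: int
  assumes N: "1 \<le> N" and M: "1 \<le> M" and height: "12 * M * N^2 \<le> Q" and disc: "5 * M \<le> S"
  shows "N^2 / 3 * M^3 \<le> card (nondegenerate_forms Q S)"
proof -
  define C where "C = {(x, y). x \<in> {1..N} \<and> y \<in> {1..N} \<and> coprime x y}"
  have "\<forall>z\<in>C. \<exists>u w. fst z * w - u * snd z = 1 \<and> 0 \<le> u \<and> u \<le> fst z \<and> 0 \<le> w \<and> w \<le> snd z"
  proof
    fix z assume "z \<in> C"
    then have "coprime (fst z) (snd z)" "1 \<le> fst z" "1 \<le> snd z" by (auto simp: C_def)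
    then show "\<exists>u w. fst z * w - u * snd z = 1 \<and> 0 \<le> u \<and> u \<le> fst z \<and> 0 \<le> w \<and> w \<le> snd z"
      by (rule bezout_box) blast
  qed
  \<comment> \<open>One completing vector is fixed for every primitive vector, so that only the latter has to be
     recovered from the form.\<close>
  then obtain U W where UW: "\<And>z. z \<in> C \<Longrightarrow>
      fst z * W z - U z * snd z = 1 \<and> 0 \<le> U z \<and> U z \<le> fst z \<and> 0 \<le> W z \<and> W z \<le> snd z"
    by metis
  define I where "I = C \<times> ({1..M} \<times> {M + 1..2 * M} \<times> {2 * M + 1..3 * M})"
  define F where "F = (\<lambda>(z, n, m, k). transform (fst z) (snd z) (U z) (W z) n m k)"
  have "inj_on F I"
  proof (rule inj_onI)
    fix i j assume i: "i \<in> I" and j: "j \<in> I" and eq: "F i = F j"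
    obtain x y n m k where i_eq: "i = ((x, y), n, m, k)" by (metis prod_cases4 surj_pair)
    obtain x' y' n' m' k' where j_eq: "j = ((x', y'), n', m', k')" by (metis prod_cases4 surj_pair)
    have xy: "coprime x y" "1 \<le> x" "1 \<le> y" and nmk: "0 < n" "n < m" "m < k" and zC: "(x, y) \<in> C"
      using i by (auto simp: i_eq I_def C_def)
    have xy': "coprime x' y'" "1 \<le> x'" "1 \<le> y'" and nmk': "0 < n'" "n' < m'" "m' < k'"
      and zC': "(x', y') \<in> C"
      using j by (auto simp: j_eq I_def C_def)
    define u w u' w' where defs: "u = U (x, y)" "w = W (x, y)" "u' = U (x', y')" "w' = W (x', y')"
    have det: "x * w - u * y = 1" "x' * w' - u' * y' = 1"
      using UW[OF zC] UW[OF zC'] by (auto simp: defs)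
    obtain a b c where abc: "transform x y u w n m k = (a, b, c)" by (metis prod_cases3)
    have abc': "transform x' y' u' w' n' m' k' = (a, b, c)"
      using eq abc by (simp add: F_def i_eq j_eq defs)
    have val: "a * x^2 + b * x * y + c * y^2 = m"
      using transform_value[OF abc, of x y] det by (simp add: algebra_simps)
    have val': "a * x'^2 + b * x' * y' + c * y'^2 = m'"
      using transform_value[OF abc', of x' y'] det by (simp add: algebra_simps)
    have "x * y' = y * x'"
    proof (cases "m' \<le> m")
      case True
      have "x * y' - y * x' = 0"
        by (rule reduced_form_min[OF nmk, of "w * x' - u * y'"])
           (use True val' transform_value[OF abc, of x' y'] in simp)
      then show ?thesis by simp
    next
      case False
      have "x' * y - y' * x = 0"
        by (rule reduced_form_min[OF nmk', of "w' * x - u' * y"])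
           (use False val transform_value[OF abc', of x y] in simp)
      then show ?thesis by (simp add: algebra_simps)
    qed
    then have same: "x = x' \<and> y = y'"
      by (rule coprime_parallel_eq[OF xy(1) xy'(1) xy(2,3) xy'(2,3)])
    then have "transform x y u w n m k = transform x y u w n' m' k'"
      using abc abc' by (simp add: defs)
    from transform_inj[OF this det(1)] same show "i = j" by (simp add: i_eq j_eq)
  qed
  moreover have "F ` I \<subseteq> nondegenerate_forms Q S"
  proof (rule image_subsetI)
    fix i assume i: "i \<in> I"
    obtain x y n m k where i_eq: "i = ((x, y), n, m, k)" by (metis prod_cases4 surj_pair)
    define u w where defs: "u = U (x, y)" "w = W (x, y)"
    have zC: "(x, y) \<in> C" and xy: "1 \<le> x" "x \<le> N" "1 \<le> y" "y \<le> N"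
      and nmk: "0 < n" "n < m" "m < k" "n \<le> M" "m \<le> 2 * M" "k \<le> 3 * M"
      using i by (auto simp: i_eq I_def C_def)
    have det: "x * w - u * y = 1" and uw: "0 \<le> u" "u \<le> N" "0 \<le> w" "w \<le> N"
      using UW[OF zC] xy by (auto simp: defs)
    obtain a b c where abc: "transform x y u w n m k = (a, b, c)" by (metis prod_cases3)
    have "2 * (m + n + k) * N^2 \<le> 12 * M * N^2"
      using nmk by (intro mult_right_mono) auto
    then have "real_of_int (2 * (m + n + k) * N^2) \<le> Q"
      using height by (metis of_int_le_iff order.trans of_int_mult of_int_numeral of_int_power)
    moreover have h: "\<bar>a\<bar> \<le> 2 * (m + n + k) * N^2" "\<bar>b\<bar> \<le> 2 * (m + n + k) * N^2" "\<bar>c\<bar> \<le> 2 * (m + n + k) * N^2"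
      using transform_height[OF abc, of N] xy uw nmk by auto
    ultimately have "real_of_int \<bar>a\<bar> \<le> Q" "real_of_int \<bar>b\<bar> \<le> Q" "real_of_int \<bar>c\<bar> \<le> Q"
      by (meson of_int_le_iff order.trans)+
    moreover have neg: "b^2 - 4 * a * c < 0 \<and> \<bar>b^2 - 4 * a * c\<bar> \<le> 25 * M^2"
    proof -
      have "m * m \<le> m * k" using nmk by (intro mult_left_mono) auto
      moreover have "m * k \<le> (2 * M) * (3 * M)" using nmk by (intro mult_mono) auto
      then have "m * k \<le> 6 * (M * M)" by simp
      moreover have "n * n < m * m" using nmk by (intro mult_strict_mono) auto
      moreover have "0 \<le> n * n" "0 \<le> M * M" by simp_all
      moreover have "b^2 - 4 * a * c = n * n - 4 * (m * k)"
        using transform_discr[OF abc det] by (simp add: power2_eq_square)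
      ultimately show ?thesis unfolding power2_eq_square[of M] by linarith
    qed
    moreover have "real_of_int \<bar>b^2 - 4 * a * c\<bar> \<le> S^2"
    proof -
      have "real_of_int \<bar>b^2 - 4 * a * c\<bar> \<le> real_of_int (25 * M^2)"
        using neg by (simp only: of_int_le_iff)
      also have "\<dots> \<le> S^2"
        using power_mono[OF disc, of 2] M by (simp add: power_mult_distrib)
      finally show ?thesis .
    qed
    moreover have "a \<noteq> 0"
    proof
      assume "a = 0"
      then have "b^2 - 4 * a * c \<ge> 0" by simp
      with neg show False by linarith
    qed
    moreover have "b^2 - 4 * a * c \<noteq> 0" using neg by simp
    moreover have "F i = (a, b, c)" using abc by (simp add: F_def i_eq defs)
    ultimately show "F i \<in> nondegenerate_forms Q S"
      unfolding nondegenerate_forms_def bounded_forms_def mem_Collect_eq by (simp only: prod.case) simp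
  qed
  moreover have "finite (nondegenerate_forms Q S)"
    by (rule finite_subset[OF _ finite_bounded_forms[of Q S]]) (auto simp: nondegenerate_forms_def)
  ultimately have "card I \<le> card (nondegenerate_forms Q S)"
    by (rule card_inj_on_le)
  moreover have "real (card I) = card C * M^3"
    using M by (simp add: I_def card_cartesian_product power3_eq_cube)
  moreover have "N^2 / 3 \<le> card C"
    unfolding C_def using N by (intro card_coprime_pairs_ge) simp
  then have "N^2 / 3 * M^3 \<le> real (card C) * real_of_int (M^3)" using M by (intro mult_right_mono) auto
  ultimately show ?thesis by simp
qed

text \<open>The largest admissible \<open>M\<close> is about \<open>S/5\<close>, and \<open>N\<^sup>2\<close> about \<open>Q/(3 S)\<close> keeps
  \<open>12 M N\<^sup>2\<close> below \<open>Q\<close>. Rounding down costs at most a factor \<open>2\<close> in each.\<close>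
lemma card_nondegenerate_ge:
  fixes Q S :: real
  assumes S: "5 \<le> S" "3 * S \<le> Q"
  shows "Q * S^2 / 36000 \<le> card (nondegenerate_forms Q S)"
proof -
  define r where "r = sqrt (Q / (3 * S))"
  define N where "N = \<lfloor>r\<rfloor>"
  define M where "M = \<lfloor>S / 5\<rfloor>"
  have r1: "1 \<le> r" using S by (simp add: r_def)
  have r2: "r^2 * (3 * S) = Q" using S by (simp add: r_def)
  have N: "1 \<le> N" "N \<le> r" "r / 2 \<le> N" 
  proof -
    show N1: "1 \<le> N" using r1 by (simp add: N_def le_floor_iff)
    show "N \<le> r" "r / 2 \<le> N" using N1 unfolding N_def by linarith+
  qed
  have M: "1 \<le> M" "5 * M \<le> S" "S / 10 \<le> M" 
  proof -
    show M1: "1 \<le> M" using S by (simp add: M_def le_floor_iff)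
    show "5 * M \<le> S" "S / 10 \<le> M" using M1 unfolding M_def by linarith+
  qed
  have "12 * M * (real_of_int N)^2 \<le> (12 / 5 * S) * r^2"
    using N M by (intro mult_mono power_mono) auto
  also have "\<dots> \<le> r^2 * (3 * S)" using S by (simp add: mult_right_mono)
  finally have h: "12 * M * (real_of_int N)^2 \<le> Q" using r2 by simp
  have "Q * S^2 / 36000 = (r / 2)^2 / 3 * (S / 10)^3"
    unfolding r2[symmetric] by (simp add: power2_eq_square power3_eq_cube)
  also have "\<dots> \<le> (real_of_int N)^2 / 3 * M^3"
    using N M r1 S by (intro mult_mono divide_right_mono power_mono) auto
  also have "\<dots> \<le> card (nondegenerate_forms Q S)"
    using card_nondegenerate_ge_box[OF N(1) M(1) _ M(2)] h by simp
  finally show ?thesis .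
qed

section \<open>Polynomials of degree two as forms\<close>

lemma quad_height_le_iff:
  "real_of_int (quad_height P) \<le> Q \<longleftrightarrow> real_of_int \<bar>coeff P 2\<bar> \<le> Q \<and>
     real_of_int \<bar>coeff P 1\<bar> \<le> Q \<and> real_of_int \<bar>coeff P 0\<bar> \<le> Q"
  unfolding quad_height_def le_floor_iff[symmetric] by simp

lemma card_D2_eq:
  assumes "1 \<le> Q"
  shows "card (D2 Q v) = card (nondegenerate_forms Q (Q powr (1 - v)))"
proof -
  have S2: "Q powr (2 - 2 * v) = (Q powr (1 - v))^2"
    using assms by (simp add: power2_eq_square flip: powr_add)
  define f where "f = (\<lambda>P::int poly. (coeff P 2, coeff P 1, coeff P 0))"
  have "bij_betw f (D2 Q v) (nondegenerate_forms Q (Q powr (1 - v)))"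
  proof (rule bij_betw_byWitness[where f' = "\<lambda>(a, b, c). [:c, b, a:]"])
    show "\<forall>P\<in>D2 Q v. (case f P of (a, b, c) \<Rightarrow> [:c, b, a:]) = P"
    proof
      fix P assume "P \<in> D2 Q v"
      then have "degree P = 2" by (simp add: D2_def)
      then show "(case f P of (a, b, c) \<Rightarrow> [:c, b, a:]) = P"
        by (intro poly_eqI) (auto simp: f_def coeff_pCons numeral_2_eq_2 coeff_eq_0 split: nat.split)
    qed
    show "\<forall>t\<in>nondegenerate_forms Q (Q powr (1 - v)). f (case t of (a, b, c) \<Rightarrow> [:c, b, a:]) = t"
      by (auto simp: f_def numeral_2_eq_2)
    show "f ` D2 Q v \<subseteq> nondegenerate_forms Q (Q powr (1 - v))"
    proof (rule image_subsetI)
      fix P assume P: "P \<in> D2 Q v"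
      then have "coeff P 2 \<noteq> 0" by (auto simp: D2_def) (metis leading_coeff_0_iff degree_0 zero_neq_numeral)
      with P show "f P \<in> nondegenerate_forms Q (Q powr (1 - v))"
        by (simp add: f_def D2_def S2 nondegenerate_forms_def bounded_forms_def quad_height_le_iff
            quad_discr_def del: of_int_abs) linarith
    qed
    show "(\<lambda>(a, b, c). [:c, b, a:]) ` nondegenerate_forms Q (Q powr (1 - v)) \<subseteq> D2 Q v"
    proof (rule image_subsetI)
      fix t assume t: "t \<in> nondegenerate_forms Q (Q powr (1 - v))"
      obtain a b c where t_eq: "t = (a, b, c)" by (metis prod_cases3)
      have "1 \<le> \<bar>b^2 - 4 * a * c\<bar>"
      proof -
        have "b^2 - 4 * a * c \<noteq> 0" using t by (simp add: t_eq nondegenerate_forms_def)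
        then show ?thesis by linarith
      qed
      with t show "(case t of (a, b, c) \<Rightarrow> [:c, b, a:]) \<in> D2 Q v"
        by (simp add: t_eq D2_def S2 nondegenerate_forms_def bounded_forms_def quad_height_le_iff
            quad_discr_def numeral_2_eq_2 del: of_int_abs)
    qed
  qed
  then show ?thesis by (rule bij_betw_same_card)
qed

theorem theorem3:
  shows "\<exists>C1 C2 :: real. C1 > 0 \<and> C2 > 0 \<and>
    (\<forall>v :: real. 0 < v \<and> v < 1 \<longrightarrow>
      (\<exists>Q0 :: real. Q0 > 1 \<and>
        (\<forall>Q :: real. Q \<ge> Q0 \<longrightarrow>
          C1 * Q powr (3 - 2 * v) \<le> real (card (D2 Q v)) \<and>
          real (card (D2 Q v)) \<le> C2 * Q powr (3 - 2 * v))))"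
proof -
  have "\<exists>Q0::real. Q0 > 1 \<and> (\<forall>Q::real. Q \<ge> Q0 \<longrightarrow>
      1 / 36000 * Q powr (3 - 2 * v) \<le> real (card (D2 Q v)) \<and>
      real (card (D2 Q v)) \<le> 18000 * Q powr (3 - 2 * v))"
    if v: "0 < v" "v < 1" for v :: real
  proof -
    have "eventually (\<lambda>Q. 5 \<le> Q powr (1 - v)) at_top" using v by real_asymp
    moreover have "eventually (\<lambda>Q. 3 * Q powr (1 - v) \<le> Q) at_top" using v by real_asymp
    moreover have "eventually (\<lambda>Q. ln (2 * Q + 1) \<le> Q powr (1 - v)) at_top" using v by real_asymp
    ultimately have "eventually (\<lambda>Q. 5 \<le> Q powr (1 - v) \<and> 3 * Q powr (1 - v) \<le> Q \<and>
        ln (2 * Q + 1) \<le> Q powr (1 - v)) at_top"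
      by (intro eventually_conj)
    then obtain Q1 where Q1: "\<And>Q. Q \<ge> Q1 \<Longrightarrow> 5 \<le> Q powr (1 - v) \<and> 3 * Q powr (1 - v) \<le> Q \<and>
        ln (2 * Q + 1) \<le> Q powr (1 - v)"
      unfolding eventually_at_top_linorder by blast
    have "1 / 36000 * Q powr (3 - 2 * v) \<le> real (card (D2 Q v)) \<and>
        real (card (D2 Q v)) \<le> 18000 * Q powr (3 - 2 * v)" if "Q \<ge> max 2 Q1" for Q
    proof -
      define S where "S = Q powr (1 - v)"
      have S: "5 \<le> S" "3 * S \<le> Q" "ln (2 * Q + 1) \<le> S" using Q1[of Q] that by (auto simp: S_def)
      have Q: "1 \<le> Q" using that by simp
      have "Q powr (3 - 2 * v) = Q powr (1 + ((1 - v) + (1 - v)))" by (simp add: algebra_simps)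
      also have "\<dots> = Q * S^2"
        using Q unfolding powr_add S_def power2_eq_square by simp
      finally have main: "Q powr (3 - 2 * v) = Q * S^2" .
      have eq: "card (D2 Q v) = card (nondegenerate_forms Q S)"
        unfolding S_def by (rule card_D2_eq[OF Q])
      have "card (nondegenerate_forms Q S) \<le> card (bounded_forms Q S)"
        by (rule card_mono[OF finite_bounded_forms]) (auto simp: nondegenerate_forms_def)
      also have "real (card (bounded_forms Q S)) \<le> 18000 * (Q * S^2)"
        using S by (intro card_bounded_forms_le) auto
      finally show ?thesis
        using card_nondegenerate_ge[OF S(1,2)] unfolding main eq by simp
    qed
    then show ?thesis by (intro exI[of _ "max 2 Q1"]) auto
  qed
  then show ?thesis by (intro exI[of _ "1 / 36000"] exI[of _ 18000]) auto
qed

end
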